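(* Let $G$ be a graph with vertex set $V=\{v_1,\dots,v_n\}$, let $X\subseteq V$, and let $G^X$ be the Seidel switch of $G$ with respect to $X$. Then for every vertex $v_i$, $$\mathcal{E}_S(v_i;G^X)=\mathcal{E}_S(v_i;G).$$
   Context: All graphs are finite, simple and undirected. The Seidel switch of $G$ with respect to $X\subseteq V$ is the graph $G^X$ on the same vertex set $V$ in which adjacency between a vertex of $X$ and a vertex of $V\setminus X$ is complemented, while edges inside $X$ and inside $V\setminus X$ remain unchanged. The Seidel matrix of a graph $G$ with vertex set $\{v_1,\dots,v_n\}$ is the real symmetric $n\times n$ matrix $S(G)=[s_{ij}]$ with $s_{ii}=0$, and for $i\neq j$, $s_{ij}=-1$ if $v_i$ and $v_j$ are adjacent and $s_{ij}=1$ otherwise. For a real symmetric matrix $S$, $|S|=(S^2)^{1/2}$ is the positive semidefinite square root of $S^2$. The vertex Seidel energy of $v_i$ in $G$ is $\mathcal{E}_S(v_i;G)=|S(G)|_{ii}$, the $i$-th diagonal entry of $|S(G)|$. *)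

theory Defs
  imports "HOL-Analysis.Analysis"
begin

text \<open>
  A finite simple undirected graph is given by its adjacency relation on a vertex type of class
  \<open>finite\<close>; the vertex set is the whole type, and the same type indexes the matrices.
\<close>

definition simple_graph :: "('v \<Rightarrow> 'v \<Rightarrow> bool) \<Rightarrow> bool" where
  "simple_graph E \<longleftrightarrow> symp E \<and> irreflp E"

definition seidel_switch :: "'v set \<Rightarrow> ('v \<Rightarrow> 'v \<Rightarrow> bool) \<Rightarrow> 'v \<Rightarrow> 'v \<Rightarrow> bool" where
  "seidel_switch X E u v \<longleftrightarrow> (if (u \<in> X) \<noteq> (v \<in> X) then \<not> E u v else E u v)"

lemma simple_graph_seidel_switch:
  "simple_graph E \<Longrightarrow> simple_graph (seidel_switch X E)"
  unfolding simple_graph_def seidel_switch_def symp_def irreflp_def by auto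

definition seidel_matrix :: "('v \<Rightarrow> 'v \<Rightarrow> bool) \<Rightarrow> real ^ 'v ^ 'v::finite" where
  "seidel_matrix E = (\<chi> i j. if i = j then 0 else if E i j then -1 else 1)"

definition psd_matrix :: "real ^ 'n ^ 'n::finite \<Rightarrow> bool" where
  "psd_matrix A \<longleftrightarrow> transpose A = A \<and> (\<forall>x. 0 \<le> x \<bullet> (A *v x))"

text \<open>
  A positive semidefinite matrix has exactly one positive semidefinite square root, so the
  description below is proper on such matrices; for other arguments its value is unspecified.
  It is only applied to \<open>S ** S\<close> with \<open>S\<close> symmetric, which is positive semidefinite.
\<close>

definition psd_sqrt :: "real ^ 'n ^ 'n \<Rightarrow> real ^ 'n ^ 'n::finite" where
  "psd_sqrt M = (THE B. psd_matrix B \<and> B ** B = M)"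

definition matrix_abs :: "real ^ 'n ^ 'n \<Rightarrow> real ^ 'n ^ 'n::finite" where
  "matrix_abs S = psd_sqrt (S ** S)"

definition vertex_seidel_energy :: "('v \<Rightarrow> 'v \<Rightarrow> bool) \<Rightarrow> 'v::finite \<Rightarrow> real" where
  "vertex_seidel_energy E v = matrix_abs (seidel_matrix E) $ v $ v"

end

theory Submission
  imports Defs
begin

text \<open>
  Switching conjugates the Seidel matrix by a diagonal \<open>\<plusminus>1\<close> matrix \<open>D\<close>. Since \<open>D\<close> is symmetric and
  \<open>D\<^sup>2 = 1\<close>, conjugation by \<open>D\<close> maps the positive semidefinite square roots of \<open>S\<^sup>2\<close> onto those of
  \<open>(D S D)\<^sup>2\<close>, and it does not change diagonal entries. Square roots are unique: if \<open>B\<close> and \<open>C\<close> are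
  both positive semidefinite with \<open>B\<^sup>2 = C\<^sup>2\<close>, then \<open>(B - C) B (B - C)\<close> and \<open>(B - C) C (B - C)\<close> are
  positive semidefinite and their traces add up to \<open>0\<close>, so \<open>B (B - C) = C (B - C) = 0\<close>, whence
  \<open>(B - C)\<^sup>2 = 0\<close> and \<open>B = C\<close>.
\<close>

lemma matrix_add_rdistrib: "(A + B) ** C = A ** C + B ** (C :: 'a::semiring_1 ^ 'n ^ 'm)"
  by (simp add: matrix_matrix_mult_def vec_eq_iff distrib_right sum.distrib)

lemma matrix_diff_ldistrib: "A ** (B - C) = A ** B - A ** (C :: 'a::ring_1 ^ 'n ^ 'm)"
  by (simp add: matrix_matrix_mult_def vec_eq_iff right_diff_distrib sum_subtractf)

lemma matrix_diff_rdistrib: "(A - B) ** C = A ** C - B ** (C :: 'a::ring_1 ^ 'n ^ 'm)"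
  by (simp add: matrix_matrix_mult_def vec_eq_iff left_diff_distrib sum_subtractf)

lemma inner_transpose_matrix_vector:
  fixes A :: "real ^ 'n ^ 'm"
  shows "x \<bullet> (transpose A *v y) = (A *v x) \<bullet> y"
  using dot_lmul_matrix[of y A x] by (simp add: inner_commute)

lemma psd_matrix_conj:
  assumes "psd_matrix A"
  shows "psd_matrix (transpose Q ** A ** Q)"
  unfolding psd_matrix_def
proof (intro conjI allI)
  have "transpose A = A" using assms by (simp add: psd_matrix_def)
  then show "transpose (transpose Q ** A ** Q) = transpose Q ** A ** Q"
    by (simp add: matrix_transpose_mul matrix_mul_assoc)
next
  fix x
  have "x \<bullet> ((transpose Q ** A ** Q) *v x) = (Q *v x) \<bullet> (A *v (Q *v x))"
    by (simp add: inner_transpose_matrix_vector del: transpose_matrix_vector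
        flip: matrix_vector_mul_assoc)
  then show "0 \<le> x \<bullet> ((transpose Q ** A ** Q) *v x)"
    using assms by (simp add: psd_matrix_def)
qed

text \<open>Moving from \<open>y\<close> in direction \<open>z = A *v y\<close>, the form becomes
  2ta + t^2 b. If a > 0, the linear term wins for small negative t and makes it negative.\<close>

lemma psd_matrix_quadratic_form_eq_0:
  assumes "psd_matrix A" and "y \<bullet> (A *v y) = 0"
  shows "A *v y = 0"
proof (rule ccontr)
  define z where "z = A *v y"
  define a b where "a = z \<bullet> z" and "b = z \<bullet> (A *v z)"
  assume "A *v y \<noteq> 0"
  then have a: "a > 0" by (simp add: a_def z_def)
  have b: "b \<ge> 0" using assms(1) by (simp add: b_def psd_matrix_def)
  have sym: "y \<bullet> (A *v z) = a"
    using assms(1) inner_transpose_matrix_vector[of y A z]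
    by (simp add: psd_matrix_def a_def z_def)
  \<comment> \<open>For b > 0 the minimum is at -a/b; the denominator b + 1 also covers b = 0 and
    still gives a negative value.\<close>
  define t where "t = - (a / (b + 1))"
  have "(y + t *\<^sub>R z) \<bullet> (A *v (y + t *\<^sub>R z)) = 2 * t * a + t\<^sup>2 * b"
    using assms(2) sym
    by (simp add: matrix_vector_right_distrib matrix_vector_mult_scaleR inner_add_left inner_add_right
        power2_eq_square a_def b_def distrib_left flip: z_def)
  also have "\<dots> = - (a\<^sup>2 * (b + 2) / (b + 1)\<^sup>2)"
    using b by (simp add: t_def divide_simps power2_eq_square) (simp add: algebra_simps)
  also have "\<dots> < 0" using a b by simp
  finally show False
    using assms(1) unfolding psd_matrix_def by (meson not_le)
qed

lemma diag_eq_inner_axis: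
  fixes A :: "real ^ 'n ^ 'n"
  shows "A $ i $ i = axis i 1 \<bullet> (A *v axis i 1)"
  by (simp add: inner_axis' matrix_vector_mult_basis column_def)

lemma psd_matrix_diag_nonneg: "psd_matrix A \<Longrightarrow> 0 \<le> A $ i $ i"
  by (simp add: diag_eq_inner_axis psd_matrix_def)

text \<open>The trace sums the quadratic form of \<open>A\<close> over the columns of
  \<open>Q\<close>. All summands are nonnegative, so each vanishes and \<open>A\<close> kills every
  column.\<close>

lemma psd_matrix_trace_conj_eq_0:
  assumes "psd_matrix A" and "trace (transpose Q ** A ** Q) = 0"
  shows "A ** Q = 0"
proof -
  let ?P = "transpose Q ** A ** Q"
  have "A *v (Q *v axis i 1) = 0" for i
  proof (rule psd_matrix_quadratic_form_eq_0[OF assms(1)])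
    have "?P $ i $ i = 0"
      using assms psd_matrix_diag_nonneg[OF psd_matrix_conj[OF assms(1)], of Q]
      by (simp add: trace_def sum_nonneg_eq_0_iff)
    then show "(Q *v axis i 1) \<bullet> (A *v (Q *v axis i 1)) = 0"
      by (simp add: diag_eq_inner_axis inner_transpose_matrix_vector del: transpose_matrix_vector
        flip: matrix_vector_mul_assoc)
  qed
  then have "column i (A ** Q) = 0" for i
    by (simp flip: matrix_vector_mult_basis matrix_vector_mul_assoc)
  then show ?thesis
    by (simp add: vec_eq_iff column_def)
qed

lemma psd_square_root_unique:
  assumes B: "psd_matrix B" and C: "psd_matrix C" and sq: "B ** B = C ** C"
  shows "B = C"
proof -
  define Q where "Q = B - C"
  have Q: "transpose Q = Q"
    using B C by (simp add: Q_def psd_matrix_def transpose_def vec_eq_iff)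
  have nonneg: "0 \<le> trace (transpose Q ** A ** Q)" if "psd_matrix A" for A
    using psd_matrix_diag_nonneg[OF psd_matrix_conj[OF that]] unfolding trace_def by (intro sum_nonneg)
  have "trace (Q ** B ** Q) + trace (Q ** C ** Q) = trace (Q ** (B + C) ** Q)"
    by (simp add: matrix_add_ldistrib matrix_add_rdistrib trace_add)
  \<comment> \<open>The squares cancel by \<open>sq\<close>. As \<open>B\<close> and
    \<open>C\<close> may fail to commute, a commutator remains; only the trace of its product with
    \<open>Q\<close> vanishes, by cyclicity.\<close>
  also have "Q ** (B + C) = B ** C - C ** B"
    by (simp add: Q_def matrix_add_ldistrib matrix_diff_ldistrib matrix_diff_rdistrib sq)
  also have "(B ** C - C ** B) ** Q = B ** C ** B - B ** (C ** C) - C ** (B ** B) + C ** B ** C"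
    by (simp add: Q_def matrix_diff_ldistrib matrix_diff_rdistrib matrix_mul_assoc)
  also have "trace \<dots> = trace (B ** (C ** B)) - trace (B ** (C ** C)) - trace (C ** (B ** B)) + trace (C ** (B ** C))"
    by (simp add: trace_add trace_sub matrix_mul_assoc)
  also have "trace (B ** (C ** B)) = trace (C ** (B ** B))"
    by (subst trace_mul_sym) (simp add: matrix_mul_assoc)
  also have "trace (C ** (B ** C)) = trace (B ** (C ** C))"
    by (subst trace_mul_sym) (simp add: matrix_mul_assoc)
  finally have "trace (Q ** B ** Q) + trace (Q ** C ** Q) = 0" by simp
  then have "B ** Q = 0" "C ** Q = 0"
    using nonneg[OF B] nonneg[OF C] B C psd_matrix_trace_conj_eq_0[of B Q]
      psd_matrix_trace_conj_eq_0[of C Q] by (auto simp: Q)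
  then have QQ: "transpose Q ** mat 1 ** Q = 0"
    by (simp add: Q) (simp add: Q_def matrix_diff_rdistrib)
  \<comment> \<open>With the identity as the middle factor, the trace lemma turns \<open>QQ\<close>
    into \<open>Q = 0\<close>.\<close>
  have "psd_matrix (mat 1 :: real ^ 'a ^ 'a)" by (simp add: psd_matrix_def)
  then have "mat 1 ** Q = 0"
    by (rule psd_matrix_trace_conj_eq_0) (simp only: QQ, simp add: trace_def)
  then show ?thesis by (simp add: Q_def)
qed

lemma psd_sqrt_eqI: "psd_matrix B \<Longrightarrow> B ** B = M \<Longrightarrow> psd_sqrt M = B"
  unfolding psd_sqrt_def by (rule the_equality) (simp, rule psd_square_root_unique, simp_all)

definition sign_matrix :: "'v set \<Rightarrow> real ^ 'v ^ 'v::finite" where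
  "sign_matrix X = (\<chi> i j. if i = j then (if i \<in> X then - 1 else 1) else 0)"

text \<open>Row i and column j are scaled by signs whose product is -1 exactly when \<open>X\<close>
  separates i and j; on the diagonal the sign is squared away.\<close>

lemma sign_matrix_conj_nth:
  "(sign_matrix X ** A ** sign_matrix X) $ i $ j = (if (i \<in> X) = (j \<in> X) then A $ i $ j else - A $ i $ j)"
proof -
  define s :: "'a \<Rightarrow> real" where "s i = (if i \<in> X then - 1 else 1)" for i
  have D: "sign_matrix X $ i $ j = (if i = j then s i else 0)" for i j
    by (simp add: sign_matrix_def s_def)
  have "(sign_matrix X ** A) $ i $ k = s i * A $ i $ k" for k
    by (simp add: matrix_matrix_mult_def D mult_delta_left)
  then have "(sign_matrix X ** A ** sign_matrix X) $ i $ j = s i * A $ i $ j * s j"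
    by (simp add: matrix_matrix_mult_def[of _ "sign_matrix X"] D mult_delta_right)
  then show ?thesis by (simp add: s_def)
qed

lemma transpose_sign_matrix: "transpose (sign_matrix X) = sign_matrix X"
  by (auto simp: transpose_def sign_matrix_def vec_eq_iff)

text \<open>Serves to pull a square root of the conjugated matrix back to a root of the
  original.\<close>

lemma sign_matrix_conj_conj:
  "sign_matrix X ** (sign_matrix X ** A ** sign_matrix X) ** sign_matrix X = A"
  by (simp add: vec_eq_iff sign_matrix_conj_nth)

lemma sign_matrix_involution: "sign_matrix X ** sign_matrix X = mat 1"
  by (auto simp: vec_eq_iff mat_def matrix_matrix_mult_def sign_matrix_def mult_delta_left)

lemma sign_matrix_conj_mult:
  "(sign_matrix X ** A ** sign_matrix X) ** (sign_matrix X ** B ** sign_matrix X)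
    = sign_matrix X ** (A ** B) ** sign_matrix X"
proof -
  have "(sign_matrix X ** A ** sign_matrix X) ** (sign_matrix X ** B ** sign_matrix X)
      = sign_matrix X ** A ** (sign_matrix X ** sign_matrix X) ** B ** sign_matrix X"
    by (simp only: matrix_mul_assoc)
  then show ?thesis by (simp add: sign_matrix_involution matrix_mul_assoc)
qed

lemma psd_matrix_sign_conj: "psd_matrix B \<Longrightarrow> psd_matrix (sign_matrix X ** B ** sign_matrix X)"
  using psd_matrix_conj[of B "sign_matrix X"] by (simp add: transpose_sign_matrix)

lemma psd_sqrt_sign_conj_diag:
  "psd_sqrt (sign_matrix X ** M ** sign_matrix X) $ v $ v = psd_sqrt M $ v $ v"
proof (cases "\<exists>B. psd_matrix B \<and> B ** B = M")
  case True
  then obtain B where B: "psd_matrix B" "B ** B = M" by blast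
  then have "psd_sqrt (sign_matrix X ** M ** sign_matrix X) = sign_matrix X ** B ** sign_matrix X"
    by (intro psd_sqrt_eqI psd_matrix_sign_conj) (simp_all add: sign_matrix_conj_mult)
  with B show ?thesis by (simp add: psd_sqrt_eqI sign_matrix_conj_nth)
next
  \<comment> \<open>Both sides are then the same junk value \<open>THE B. False\<close>, so existence of roots is not needed.\<close>
  case False
  have "\<nexists>B. psd_matrix B \<and> B ** B = sign_matrix X ** M ** sign_matrix X"
    using False by (metis psd_matrix_sign_conj sign_matrix_conj_conj sign_matrix_conj_mult)
  with False have "(\<lambda>B. psd_matrix B \<and> B ** B = sign_matrix X ** M ** sign_matrix X)
      = (\<lambda>B. psd_matrix B \<and> B ** B = M)" by blast
  then show ?thesis by (simp only: psd_sqrt_def)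
qed

text \<open>With adjacency encoded as -1 and non-adjacency as 1, complementing a pair across
  \<open>X\<close> negates its entry.\<close>

lemma seidel_matrix_switch:
  "seidel_matrix (seidel_switch X E) = sign_matrix X ** seidel_matrix E ** sign_matrix X"
  unfolding vec_eq_iff sign_matrix_conj_nth by (auto simp: seidel_matrix_def seidel_switch_def)

theorem theorem6:
  fixes E :: "'v::finite \<Rightarrow> 'v \<Rightarrow> bool" and X :: "'v set" and v :: 'v
  assumes "simple_graph E"
  shows "vertex_seidel_energy (seidel_switch X E) v = vertex_seidel_energy E v"
  by (simp add: vertex_seidel_energy_def matrix_abs_def seidel_matrix_switch sign_matrix_conj_mult
      psd_sqrt_sign_conj_diag)

end
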